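(* Let $\{f_{i,j}\}_{i,j\in\{1,2\}}$ and $\{g_{i,j}\}_{i,j\in\{1,2\}}$ be two compatible families on $[0,1]$ with a common comparison function $\phi$ under the Euclidean distance, and let $\varphi_1,\varphi_2:[0,1]\to[0,1]$ be the associated maps defined in the context. Let $i\in\{1,2\}$. Then: (i) $\varphi_i$ is increasing on $[0,1]$. (ii) $\varphi_i$ is continuous on $[0,1]$ (with the topology induced by the Euclidean metric). (iii) The pair of maps $(\varphi_1,\varphi_2)$ satisfies the system of functional equations $$g_{i,j}\circ\varphi_j=\varphi_i\circ f_{i,j},\qquad i,j\in\{1,2\}.$$
   Context: A comparison function is a map $\phi:[0,\infty)\to[0,\infty)$ that is increasing (in the weak sense) with $\lim_{n\to\infty}\phi^n(t)=0$ for every $t>0$, where $\phi^n$ is the $n$-fold iterate. A map $h:[0,1]\to[0,1]$ is a $\phi$-contraction if $|h(x)-h(y)|\le\phi(|x-y|)$ for all $x,y$. "Increasing" means weakly increasing. A doubly-indexed family of functions $h_{i,j}$, $i,j\in\{1,2\}$, on $[0,1]$ is a compatible family with comparison function $\phi$ if each $h_{i,j}$ is strictly increasing and a $\phi$-contraction, and $0=h_{i,1}(0)<h_{i,1}(1)=h_{i,2}(0)<h_{i,2}(1)=1$ for $i=1,2$. For a compatible family $h$, $i\in\{1,2\}$, $n\ge1$, and $i_1,\dots,i_n\in\{1,2\}$, put $h_{i;i_1,\dots,i_n}=h_{i,i_1}\circ h_{i_1,i_2}\circ\cdots\circ h_{i_{n-1},i_n}$ (for $n=1$ this is $h_{i,i_1}$),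 $I^h_i(i_1,\dots,i_n)=[h_{i;i_1,\dots,i_n}(0),h_{i;i_1,\dots,i_n}(1)]$, $D^h_{i,n}=\{h_{i;i_1,\dots,i_n}(x_n): i_1,\dots,i_n\in\{1,2\},\ x_n\in\{0,1\}\}$ and $D^h_i=\bigcup_{n\ge1}D^h_{i,n}$. For every $x\in[0,1]$ there is a sequence $(i_n)_n$ in $\{1,2\}$ with $x\in I^h_i(i_1,\dots,i_n)$ for all $n$, and it is unique if $x\notin D^h_i$; moreover the maximal length of the intervals $I^h_i(i_1,\dots,i_n)$ tends to $0$ as $n\to\infty$. Definition of $\varphi_i$, $i=1,2$: on $D^f_i$, set $\varphi_i(f_{i;i_1,\dots,i_n}(x_n))=g_{i;i_1,\dots,i_n}(x_n)$ for $n\ge 1$, $i_1,\dots,i_n\in\{1,2\}$, $x_n\in\{0,1\}$ (this is well defined). For $x\in[0,1]\setminus D^f_i$, let $(i_n)_n$ be the unique sequence in $\{1,2\}$ with $x\in I^f_i(i_1,\dots,i_n)$ for every $n\ge1$; then $\bigcap_{n\ge1}I^g_i(i_1,\dots,i_n)$ is a singleton $\{y\}$, and $\varphi_i(x):=y$. *)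

theory Defs
  imports "HOL-Analysis.Analysis"
begin

text \<open>Maps on \<open>[0,\<infinity>)\<close> and \<open>[0,1]\<close> are total functions on the reals; every condition is
  relativised to the relevant interval. Indices are the natural numbers 1 and 2.\<close>

definition comparison_function :: "(real \<Rightarrow> real) \<Rightarrow> bool" where
  "comparison_function \<phi> \<longleftrightarrow>
     \<phi> \<in> {0..} \<rightarrow> {0..} \<and> mono_on {0..} \<phi> \<and>
     (\<forall>t>0. (\<lambda>n. (\<phi> ^^ n) t) \<longlonglongrightarrow> 0)"

definition phi_contraction :: "(real \<Rightarrow> real) \<Rightarrow> (real \<Rightarrow> real) \<Rightarrow> bool" where
  "phi_contraction \<phi> h \<longleftrightarrow>
     h \<in> {0..1} \<rightarrow> {0..1} \<and>
     (\<forall>x\<in>{0..1}. \<forall>y\<in>{0..1}. \<bar>h x - h y\<bar> \<le> \<phi> \<bar>x - y\<bar>)"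

definition compatible_family ::
  "(real \<Rightarrow> real) \<Rightarrow> (nat \<Rightarrow> nat \<Rightarrow> real \<Rightarrow> real) \<Rightarrow> bool" where
  "compatible_family \<phi> h \<longleftrightarrow>
     comparison_function \<phi> \<and>
     (\<forall>i\<in>{1,2}. \<forall>j\<in>{1,2}. strict_mono_on {0..1} (h i j) \<and> phi_contraction \<phi> (h i j)) \<and>
     (\<forall>i\<in>{1,2}. 0 = h i 1 0 \<and> h i 1 0 < h i 1 1 \<and> h i 1 1 = h i 2 0 \<and>
                 h i 2 0 < h i 2 1 \<and> h i 2 1 = 1)"

text \<open>\<open>word_map h i [i\<^sub>1, \<dots>, i\<^sub>n]\<close> is
  \<open>h\<^bsub>i,i\<^sub>1\<^esub> \<circ> h\<^bsub>i\<^sub>1,i\<^sub>2\<^esub> \<circ> \<dots>\<close>, where each factor's second index is the next one's first.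
  The empty word, which only terminates the recursion, gives the identity.\<close>

fun word_map :: "(nat \<Rightarrow> nat \<Rightarrow> real \<Rightarrow> real) \<Rightarrow> nat \<Rightarrow> nat list \<Rightarrow> real \<Rightarrow> real" where
  "word_map h i [] = id"
| "word_map h i (j # w) = h i j \<circ> word_map h j w"

definition word_interval :: "(nat \<Rightarrow> nat \<Rightarrow> real \<Rightarrow> real) \<Rightarrow> nat \<Rightarrow> nat list \<Rightarrow> real set" where
  "word_interval h i w = {word_map h i w 0 .. word_map h i w 1}"

definition D_level :: "(nat \<Rightarrow> nat \<Rightarrow> real \<Rightarrow> real) \<Rightarrow> nat \<Rightarrow> nat \<Rightarrow> real set" where
  "D_level h i n =
     {word_map h i w e | w e. length w = n \<and> set w \<subseteq> {1,2} \<and> e \<in> {0,1}}"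

definition D_set :: "(nat \<Rightarrow> nat \<Rightarrow> real \<Rightarrow> real) \<Rightarrow> nat \<Rightarrow> real set" where
  "D_set h i = (\<Union>n\<in>{1..}. D_level h i n)"

text \<open>Infinite sequences are indexed from 0, so that \<open>map s [0..<n]\<close> is
  \<open>(i\<^sub>1, \<dots>, i\<^sub>n)\<close> and no unconstrained entry spoils uniqueness.\<close>

definition is_itinerary ::
  "(nat \<Rightarrow> nat \<Rightarrow> real \<Rightarrow> real) \<Rightarrow> nat \<Rightarrow> real \<Rightarrow> (nat \<Rightarrow> nat) \<Rightarrow> bool" where
  "is_itinerary h i x s \<longleftrightarrow>
     range s \<subseteq> {1,2} \<and> (\<forall>n\<ge>1. x \<in> word_interval h i (map s [0..<n]))"

text \<open>For compatible families both definite descriptions below are proper and the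
  intersection is a singleton. Only arguments in \<open>[0,1]\<close> and indices 1, 2 are meaningful.\<close>

definition assoc_map ::
  "(nat \<Rightarrow> nat \<Rightarrow> real \<Rightarrow> real) \<Rightarrow> (nat \<Rightarrow> nat \<Rightarrow> real \<Rightarrow> real) \<Rightarrow> nat \<Rightarrow> real \<Rightarrow> real" where
  "assoc_map f g i x =
     (if x \<in> D_set f i
      then (THE y. \<exists>w e. w \<noteq> [] \<and> set w \<subseteq> {1,2} \<and> e \<in> {0,1} \<and>
                         x = word_map f i w e \<and> y = word_map g i w e)
      else the_elem (\<Inter>n\<in>{1..}. word_interval g i (map (THE s. is_itinerary f i x s) [0..<n])))"

end

theory Submission
  imports Defs
begin

text \<open>
  Say that \<open>x\<close> and \<open>y\<close> are \<^emph>\<open>conjugate\<close> at index \<open>i\<close> if for every \<open>n\<close> some word \<open>w\<close> of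
  length \<open>n\<close> has \<open>x\<close> in its \<open>f\<close>-interval and \<open>y\<close> in its \<open>g\<close>-interval. All assertions follow
  once this relation is recognised as the graph of \<open>\<phi>\<^sub>i\<close>.

  The endpoints of the word intervals are ordered in the same way for \<open>f\<close> and for \<open>g\<close>
  (\<open>endpoint_order\<close>), since their order depends only on the words. As the \<open>g\<close>-intervals of
  words of length \<open>n\<close> have length at most \<open>\<phi>\<^sup>n(1)\<close>, which tends to 0, the relation is
  monotone (\<open>conjugate_mono\<close>); in particular at most one \<open>y\<close> is conjugate to a given \<open>x\<close>. The two
  clauses in the definition of \<open>\<phi>\<^sub>i\<close> both yield a point conjugate to \<open>x\<close>
  (\<open>conjugate_assoc_map\<close>), so the relation is the graph of \<open>\<phi>\<^sub>i\<close>, and \<open>\<phi>\<^sub>i\<close> is increasing.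

  For each \<open>n\<close> the condition on \<open>(x, y)\<close> describes a finite union of closed rectangles. Hence the
  graph is closed, and a map into a compact space with closed graph is continuous. Finally,
  prefixing all words by a letter \<open>j\<close> turns conjugacy of \<open>x\<close> and \<open>y\<close> at \<open>j\<close> into conjugacy of
  \<open>f\<^bsub>k,j\<^esub> x\<close> and \<open>g\<^bsub>k,j\<^esub> y\<close> at \<open>k\<close>, which is the functional equation.
\<close>

section \<open>Comparison functions\<close>

lemma comparison_function_less:
  assumes "comparison_function \<phi>" "t > 0"
  shows "\<phi> t < t"
proof (rule ccontr)
  assume "\<not> \<phi> t < t"
  then have le: "t \<le> \<phi> t" by simp
  have mono: "mono_on {0..} \<phi>" and lim: "(\<lambda>n. (\<phi> ^^ n) t) \<longlonglongrightarrow> 0"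
    using assms by (auto simp: comparison_function_def)
  have "t \<le> (\<phi> ^^ n) t" for n
  proof (induction n)
    case (Suc n)
    then have "\<phi> t \<le> \<phi> ((\<phi> ^^ n) t)"
      using assms(2) by (intro mono_onD[OF mono]) auto
    with le show ?case by simp
  qed simp
  then have "t \<le> 0"
    using LIMSEQ_le_const[OF lim, of t] by blast
  with assms(2) show False by simp
qed

section \<open>Word maps of one compatible family\<close>

text \<open>The index at which the second block starts is the last index of the first block, or
  \<open>i\<close> itself if the first block is empty.\<close>

lemma word_map_append:
  "word_map h i (u @ v) = word_map h i u \<circ> word_map h (last (i # u)) v"
  by (induction u arbitrary: i) (auto simp: comp_assoc)

lemma last_index:
  assumes "i \<in> A" "set w \<subseteq> A"
  shows "last (i # w) \<in> A"
  using assms by (induction w arbitrary: i) auto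

locale compatible =
  fixes \<phi> :: "real \<Rightarrow> real" and h :: "nat \<Rightarrow> nat \<Rightarrow> real \<Rightarrow> real"
  assumes compatible: "compatible_family \<phi> h"
begin

lemma comparison: "comparison_function \<phi>"
  using compatible by (simp add: compatible_family_def)

lemma phi_mono: "0 \<le> s \<Longrightarrow> s \<le> t \<Longrightarrow> \<phi> s \<le> \<phi> t"
  using comparison by (auto simp: comparison_function_def mono_on_def)

lemma iterates_tendsto: "(\<lambda>n. (\<phi> ^^ n) 1) \<longlonglongrightarrow> 0"
  using comparison by (simp add: comparison_function_def)

lemma endpoints:
  assumes "i \<in> {1,2}"
  shows "h i 1 0 = 0" "h i 2 0 = h i 1 1" "h i 2 1 = 1" "0 < h i 1 1" "h i 1 1 < 1"
proof -
  from compatible have "\<forall>i\<in>{1,2}. 0 = h i 1 0 \<and> h i 1 0 < h i 1 1 \<and> h i 1 1 = h i 2 0 \<and>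
                 h i 2 0 < h i 2 1 \<and> h i 2 1 = 1"
    unfolding compatible_family_def by (elim conjE)
  with assms have "0 = h i 1 0 \<and> h i 1 0 < h i 1 1 \<and> h i 1 1 = h i 2 0 \<and>
                 h i 2 0 < h i 2 1 \<and> h i 2 1 = 1"
    by (rule bspec[rotated])
  then show "h i 1 0 = 0" "h i 2 0 = h i 1 1" "h i 2 1 = 1" "0 < h i 1 1" "h i 1 1 < 1"
    by linarith+
qed

context
  fixes i j :: nat
  assumes i: "i \<in> {1,2}" and j: "j \<in> {1,2}"
begin

lemma strict_mono: "strict_mono_on {0..1} (h i j)"
  and contraction: "phi_contraction \<phi> (h i j)"
proof -
  from compatible have
    "\<forall>i\<in>{1,2}. \<forall>j\<in>{1,2}. strict_mono_on {0..1} (h i j) \<and> phi_contraction \<phi> (h i j)"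
    unfolding compatible_family_def by (elim conjE)
  with i j show "strict_mono_on {0..1} (h i j)" "phi_contraction \<phi> (h i j)"
    by blast+
qed

lemma in_unit: "x \<in> {0..1} \<Longrightarrow> h i j x \<in> {0..1}"
  using contraction by (auto simp: phi_contraction_def)

lemma le_iff: "x \<in> {0..1} \<Longrightarrow> y \<in> {0..1} \<Longrightarrow> h i j x \<le> h i j y \<longleftrightarrow> x \<le> y"
  using strict_mono by (rule strict_mono_on_less_eq)

lemma eq_iff: "x \<in> {0..1} \<Longrightarrow> y \<in> {0..1} \<Longrightarrow> h i j x = h i j y \<longleftrightarrow> x = y"
  using le_iff[of x y] le_iff[of y x] by auto

lemma continuous: "continuous_on {0..1} (h i j)"
proof (rule lipschitz_on_continuous_on)
  show "1-lipschitz_on {0..1} (h i j)"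
  proof (rule lipschitz_onI)
    fix x y :: real assume "x \<in> {0..1}" "y \<in> {0..1}"
    then have "\<bar>h i j x - h i j y\<bar> \<le> \<phi> \<bar>x - y\<bar>"
      using contraction by (auto simp: phi_contraction_def)
    moreover have "\<phi> \<bar>x - y\<bar> \<le> \<bar>x - y\<bar>" if "x \<noteq> y"
      using comparison_function_less[OF comparison, of "\<bar>x - y\<bar>"] that by simp
    ultimately show "dist (h i j x) (h i j y) \<le> 1 * dist x y"
      by (cases "x = y") (auto simp: dist_real_def)
  qed simp
qed

lemma intermediate_value:
  assumes "a \<in> {0..1}" "b \<in> {0..1}" "a \<le> b" "x \<in> {h i j a .. h i j b}"
  shows "\<exists>z\<in>{a..b}. h i j z = x"
  using assms IVT'[of "h i j" a x b] continuous_on_subset[OF continuous, of "{a..b}"] by auto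

end

lemma unit_covered:
  assumes "i \<in> {1,2}" "x \<in> {0..1}"
  obtains j z where "j \<in> {1,2}" "z \<in> {0..1}" "x = h i j z"
proof (cases "x \<le> h i 1 1")
  case True
  with assms show ?thesis
    using intermediate_value[of i 1 0 1 x] endpoints[of i] that[of 1] by force
next
  case False
  with assms show ?thesis
    using intermediate_value[of i 2 0 1 x] endpoints[of i] that[of 2] by force
qed

text \<open>The ranges of \<open>h i 1\<close> and \<open>h i 2\<close> meet in one point only.\<close>

lemma ranges_meet:
  assumes "i \<in> {1,2}" "a \<in> {0..1}" "b \<in> {0..1}" "h i 2 a \<le> h i 1 b"
  shows "a = 0" "b = 1"
proof -
  have "h i 1 b \<le> h i 1 1" "h i 2 0 \<le> h i 2 a"
    using assms by (auto simp: le_iff)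
  with assms endpoints[of i] have "h i 2 a = h i 2 0" "h i 1 b = h i 1 1"
    by auto
  with assms show "a = 0" "b = 1"
    by (auto simp: eq_iff)
qed

lemma word_map_in_unit:
  "i \<in> {1,2} \<Longrightarrow> set w \<subseteq> {1,2} \<Longrightarrow> x \<in> {0..1} \<Longrightarrow> word_map h i w x \<in> {0..1}"
proof (induction w arbitrary: i)
  case (Cons j w)
  then show ?case using in_unit[of i j] by simp
qed simp

lemma word_map_le_iff:
  assumes "i \<in> {1,2}" "set w \<subseteq> {1,2}" "x \<in> {0..1}" "y \<in> {0..1}"
  shows "word_map h i w x \<le> word_map h i w y \<longleftrightarrow> x \<le> y"
  using assms
proof (induction w arbitrary: i)
  case (Cons j w)
  then show ?case
    using le_iff[of i j "word_map h j w x" "word_map h j w y"]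
      word_map_in_unit[of j w x] word_map_in_unit[of j w y] by simp
qed simp

lemma word_interval_subset_unit:
  "i \<in> {1,2} \<Longrightarrow> set w \<subseteq> {1,2} \<Longrightarrow> word_interval h i w \<subseteq> {0..1}"
  using word_map_in_unit[of i w 0] word_map_in_unit[of i w 1] by (auto simp: word_interval_def)

lemma word_map_diff_le:
  assumes "i \<in> {1,2}" "set w \<subseteq> {1,2}" "x \<in> {0..1}" "y \<in> {0..1}"
  shows "\<bar>word_map h i w x - word_map h i w y\<bar> \<le> (\<phi> ^^ length w) \<bar>x - y\<bar>"
  using assms
proof (induction w arbitrary: i)
  case (Cons j w)
  let ?x = "word_map h j w x" and ?y = "word_map h j w y"
  have "?x \<in> {0..1}" "?y \<in> {0..1}"
    using Cons.prems word_map_in_unit[of j w] by auto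
  then have "\<bar>h i j ?x - h i j ?y\<bar> \<le> \<phi> \<bar>?x - ?y\<bar>"
    using Cons.prems contraction[of i j] by (auto simp: phi_contraction_def)
  also have "\<dots> \<le> \<phi> ((\<phi> ^^ length w) \<bar>x - y\<bar>)"
    using Cons by (intro phi_mono) auto
  finally show ?case by simp
qed simp

lemma word_interval_length:
  assumes "i \<in> {1,2}" "set w \<subseteq> {1,2}"
  shows "word_map h i w 1 - word_map h i w 0 \<le> (\<phi> ^^ length w) 1"
  using word_map_diff_le[OF assms, of 1 0] by simp

lemma word_interval_Cons:
  assumes "i \<in> {1,2}" "j \<in> {1,2}" "set w \<subseteq> {1,2}" "z \<in> word_interval h j w"
  shows "h i j z \<in> word_interval h i (j # w)"
proof -
  have "z \<in> {0..1}" "word_map h j w 0 \<in> {0..1}" "word_map h j w 1 \<in> {0..1}"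
    using assms word_interval_subset_unit[of j w] word_map_in_unit[of j w] by auto
  then show ?thesis
    using assms by (simp add: word_interval_def le_iff)
qed

lemma word_interval_ConsE:
  assumes "i \<in> {1,2}" "j \<in> {1,2}" "set w \<subseteq> {1,2}" "x \<in> word_interval h i (j # w)"
  obtains z where "z \<in> word_interval h j w" "z \<in> {0..1}" "x = h i j z"
proof -
  have "\<exists>z\<in>word_interval h j w. h i j z = x"
    unfolding word_interval_def using assms word_map_in_unit[of j w] word_map_le_iff[of j w 0 1]
    by (intro intermediate_value) (auto simp: word_interval_def)
  with that word_interval_subset_unit[of j w] assms show ?thesis by blast
qed

lemma word_map_eq_0:
  assumes "i \<in> {1,2}" "set w \<subseteq> {1,2}" "e \<in> {0..1}"
  shows "word_map h i w e = 0 \<longleftrightarrow> set w \<subseteq> {1} \<and> e = 0"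
  using assms
proof (induction w arbitrary: i)
  case (Cons j w)
  have z: "word_map h j w e \<in> {0..1}" (is "?z \<in> _")
    using Cons.prems by (intro word_map_in_unit) auto
  have "h i j ?z = 0 \<longleftrightarrow> j = 1 \<and> ?z = 0"
  proof (cases "j = 1")
    case True
    then show ?thesis
      using Cons.prems z eq_iff[of i 1 ?z 0] endpoints(1)[of i] by simp
  next
    case False
    then have "j = 2" using Cons.prems by simp
    then show ?thesis
      using Cons.prems z le_iff[of i 2 0 ?z] endpoints[of i] by auto
  qed
  then show ?case using Cons by auto
qed simp

lemma word_map_eq_1:
  assumes "i \<in> {1,2}" "set w \<subseteq> {1,2}" "e \<in> {0..1}"
  shows "word_map h i w e = 1 \<longleftrightarrow> set w \<subseteq> {2} \<and> e = 1"
  using assms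
proof (induction w arbitrary: i)
  case (Cons j w)
  have z: "word_map h j w e \<in> {0..1}" (is "?z \<in> _")
    using Cons.prems by (intro word_map_in_unit) auto
  have "h i j ?z = 1 \<longleftrightarrow> j = 2 \<and> ?z = 1"
  proof (cases "j = 2")
    case True
    then show ?thesis
      using Cons.prems z eq_iff[of i 2 ?z 1] endpoints(3)[of i] by simp
  next
    case False
    then have "j = 1" using Cons.prems by simp
    then show ?thesis
      using Cons.prems z le_iff[of i 1 ?z 1] endpoints[of i] by auto
  qed
  then show ?case using Cons by auto
qed simp

section \<open>Itineraries\<close>

text \<open>Every point of \<open>[0,1]\<close> is the image of a point of \<open>[0,1]\<close> under some \<open>h i j\<close>. Iterating this
  by dependent choice gives words, each extending the previous one by a letter, whose maps
  have \<open>x\<close> in their range.\<close>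

lemma itinerary_exists:
  assumes "i \<in> {1,2}" "x \<in> {0..1}"
  shows "\<exists>s. is_itinerary h i x s"
proof -
  let ?P = "\<lambda>n w. length w = n \<and> set w \<subseteq> {1,2} \<and> (\<exists>z\<in>{0..1}. x = word_map h i w z)"
  have "\<exists>W. \<forall>n. ?P n (W n) \<and> (\<exists>j. W (Suc n) = W n @ [j])"
  proof (rule dependent_nat_choice)
    show "\<exists>w. ?P 0 w" using assms by auto
  next
    fix w n assume w: "?P n w"
    then obtain z where z: "z \<in> {0..1}" "x = word_map h i w z" by auto
    have "last (i # w) \<in> {1,2}"
      using assms w by (intro last_index) auto
    then obtain j y where "j \<in> {1,2}" "y \<in> {0..1}" "z = h (last (i # w)) j y"
      using z unit_covered by metis
    with w z show "\<exists>v. ?P (Suc n) v \<and> (\<exists>j. v = w @ [j])"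
      by (intro exI[of _ "w @ [j]"]) (auto simp: word_map_append)
  qed
  then obtain W where W: "\<And>n. ?P n (W n)" and step: "\<And>n. \<exists>j. W (Suc n) = W n @ [j]"
    by blast
  define s where "s n = last (W (Suc n))" for n
  have prefix: "map s [0..<n] = W n" for n
  proof (induction n)
    case (Suc n)
    from step[of n] obtain j where "W (Suc n) = W n @ [j]" by blast
    with Suc show ?case by (simp add: s_def)
  qed (use W[of 0] in auto)
  have "s n \<in> {1,2}" for n
  proof -
    have "W (Suc n) \<noteq> []" using W[of "Suc n"] by auto
    then have "last (W (Suc n)) \<in> set (W (Suc n))" by (rule last_in_set)
    with W[of "Suc n"] show ?thesis unfolding s_def by blast
  qed
  moreover have "x \<in> word_interval h i (W n)" for n
    using W[of n] assms word_map_le_iff[of i "W n"] by (auto simp: word_interval_def)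
  ultimately have "is_itinerary h i x s"
    by (auto simp: is_itinerary_def prefix)
  then show ?thesis by blast
qed

lemma word_exists:
  assumes "i \<in> {1,2}" "x \<in> {0..1}"
  obtains w where "length w = n" "set w \<subseteq> {1,2}" "x \<in> word_interval h i w"
proof (cases n)
  case 0
  with assms that[of "[]"] show ?thesis by (simp add: word_interval_def)
next
  case (Suc m)
  from itinerary_exists[OF assms] obtain s where s: "is_itinerary h i x s" ..
  show ?thesis
    by (rule that[of "map s [0..<n]"]) (use s Suc in \<open>auto simp: is_itinerary_def\<close>)
qed

lemma D_set_iff:
  "x \<in> D_set h i \<longleftrightarrow> (\<exists>w e. w \<noteq> [] \<and> set w \<subseteq> {1,2} \<and> e \<in> {0,1} \<and> x = word_map h i w e)"
proof -
  have "(\<exists>n\<ge>1. length w = n) \<longleftrightarrow> w \<noteq> []" for w :: "nat list"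
    by (auto simp: Suc_le_eq)
  then show ?thesis by (auto simp: D_set_def D_level_def)
qed

lemma D_set_Cons:
  assumes "j \<in> {1,2}" "z \<in> D_set h j"
  shows "h i j z \<in> D_set h i"
proof -
  from assms(2) obtain w e where "set w \<subseteq> {1,2}" "e \<in> {0,1}" "z = word_map h j w e"
    unfolding D_set_iff by blast
  with assms(1) show ?thesis
    unfolding D_set_iff by (intro exI[of _ "j # w"] exI[of _ e]) auto
qed

text \<open>Intervals of distinct words of the same length meet in \<open>D_set h i\<close> only: at the first
  letter where the words differ, the common point is the image of \<open>h k 1 1 = h k 2 0\<close>.\<close>

lemma word_unique:
  assumes "i \<in> {1,2}" "set u \<subseteq> {1,2}" "set v \<subseteq> {1,2}" "length u = length v"
    and "x \<in> word_interval h i u" "x \<in> word_interval h i v" "x \<notin> D_set h i"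
  shows "u = v"
  using assms(4) assms(1-3,5-)
proof (induction u v arbitrary: i x rule: list_induct2)
  case (Cons j u k v)
  obtain a where a: "a \<in> word_interval h j u" "a \<in> {0..1}" "x = h i j a"
    by (rule word_interval_ConsE[of i j u x]) (use Cons.prems in auto)
  obtain b where b: "b \<in> word_interval h k v" "b \<in> {0..1}" "x = h i k b"
    by (rule word_interval_ConsE[of i k v x]) (use Cons.prems in auto)
  have "h i 1 1 \<in> D_set h i"
    unfolding D_set_iff by (intro exI[of _ "[1]"] exI[of _ 1]) auto
  with Cons.prems(6) have x: "x \<noteq> h i 1 1" by blast
  have jk: "j \<in> {1,2}" "k \<in> {1,2}"
    using Cons.prems by auto
  have "j = k"
  proof (rule ccontr)
    assume "j \<noteq> k"
    with jk have "j = 1 \<and> k = 2 \<or> j = 2 \<and> k = 1" by auto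
    then show False
      using a b x Cons.prems(1) ranges_meet[of i a b] ranges_meet[of i b a] by auto
  qed
  moreover from this have "a = b"
    using a b jk Cons.prems(1) eq_iff[of i j a b] by auto
  moreover have "a \<notin> D_set h j"
    using D_set_Cons[of j a i] a jk Cons.prems(6) by auto
  ultimately show ?case
    using Cons.IH[of j a] Cons.prems a b by simp
qed simp

lemma itinerary_unique:
  assumes "i \<in> {1,2}" "x \<notin> D_set h i" "is_itinerary h i x s" "is_itinerary h i x t"
  shows "s = t"
proof
  fix n
  have "map s [0..<Suc n] = map t [0..<Suc n]"
    by (rule word_unique[of i _ _ x])
      (use assms in \<open>simp_all add: is_itinerary_def image_subset_iff del: upt_Suc\<close>)
  then show "s n = t n" by simp
qed

lemma the_itinerary:
  assumes "i \<in> {1,2}" "x \<in> {0..1}" "x \<notin> D_set h i"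
  shows "is_itinerary h i x (THE s. is_itinerary h i x s)"
proof -
  from itinerary_exists[OF assms(1,2)] obtain s where s: "is_itinerary h i x s" ..
  then show ?thesis
    using itinerary_unique[OF assms(1,3) _ s] by (rule theI[of "is_itinerary h i x"])
qed

lemma Inter_word_intervals:
  assumes "i \<in> {1,2}" "range s \<subseteq> {1,2}"
  obtains y where "(\<Inter>n\<in>{1..}. word_interval h i (map s [0..<n])) = {y}"
proof -
  let ?w = "\<lambda>n. map s [0..<n]"
  let ?a = "\<lambda>n. word_map h i (?w n) 0" and ?b = "\<lambda>n. word_map h i (?w n) 1"
  have w: "set (?w n) \<subseteq> {1,2}" for n
    using assms by auto
  have next_in: "word_map h i (?w (Suc n)) e \<in> {?a n..?b n}" if "e \<in> {0,1}" for n e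
  proof -
    have "last (i # ?w n) \<in> {1,2}"
      using assms(1) w by (rule last_index)
    moreover have "s n \<in> {1,2}" using assms by auto
    ultimately have "h (last (i # ?w n)) (s n) e \<in> {0..1}"
      using that by (intro in_unit) auto
    then show ?thesis
      using assms w[of n] word_map_le_iff[of i "?w n"] by (simp add: word_map_append)
  qed
  have "?b n - ?a n \<le> (\<phi> ^^ n) 1" for n
    using word_interval_length[OF assms(1) w, of n] by simp
  moreover have ab: "?a n \<le> ?b n" for n
    using word_map_le_iff[OF assms(1) w, of 0 1 n] by simp
  ultimately have "(\<lambda>n. ?b n - ?a n) \<longlonglongrightarrow> 0"
    by (intro tendsto_sandwich[OF _ _ tendsto_const iterates_tendsto]) auto
  then have "(\<lambda>n. ?a n - ?b n) \<longlonglongrightarrow> 0"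
    using tendsto_minus by fastforce
  then obtain y where y: "\<And>n. ?a n \<le> y" "\<And>n. y \<le> ?b n" and lim: "?a \<longlonglongrightarrow> y" "?b \<longlonglongrightarrow> y"
    using nested_sequence_unique[of ?a ?b] next_in ab by fastforce
  have "y' = y" if "\<And>n. n \<ge> 1 \<Longrightarrow> ?a n \<le> y' \<and> y' \<le> ?b n" for y'
    using that LIMSEQ_le_const2[OF lim(1), of y'] LIMSEQ_le_const[OF lim(2), of y']
    by (meson order_antisym)
  with y show ?thesis
    by (intro that[of y]) (auto simp: word_interval_def)
qed

end

section \<open>Conjugacy between two compatible families\<close>

text \<open>The closed relation between points of \<open>[0,1]\<close> that turns out to be the graph of \<open>\<phi>\<^sub>i\<close>.
  The word may depend on \<open>n\<close> in any way: words for different \<open>n\<close> need not extend one another.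
  Length 0 only says that both points lie in \<open>[0,1]\<close>.\<close>

definition conjugate ::
  "(nat \<Rightarrow> nat \<Rightarrow> real \<Rightarrow> real) \<Rightarrow> (nat \<Rightarrow> nat \<Rightarrow> real \<Rightarrow> real) \<Rightarrow> nat \<Rightarrow> real \<Rightarrow> real \<Rightarrow> bool" where
  "conjugate f g i x y \<longleftrightarrow>
     (\<forall>n. \<exists>w. length w = n \<and> set w \<subseteq> {1,2} \<and> x \<in> word_interval f i w \<and> y \<in> word_interval g i w)"

lemma closed_conjugate: "closed {(x, y). conjugate f g i x y}"
proof -
  have "{(x, y). conjugate f g i x y} =
      (\<Inter>n. \<Union>w\<in>{w. set w \<subseteq> {1,2} \<and> length w = n}. word_interval f i w \<times> word_interval g i w)"
    unfolding conjugate_def by auto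
  moreover have "closed (\<Union>w\<in>{w. set w \<subseteq> {1,2} \<and> length w = n}.
      word_interval f i w \<times> word_interval g i w)" for n
    by (intro closed_UN finite_lists_length_eq ballI closed_Times)
      (auto simp: word_interval_def)
  ultimately show ?thesis by auto
qed

locale compatible_pair = F: compatible \<phi> f + G: compatible \<phi> g
  for \<phi> :: "real \<Rightarrow> real" and f g :: "nat \<Rightarrow> nat \<Rightarrow> real \<Rightarrow> real"
begin

text \<open>Words with the same first letter are compared after removing it. First letters 1 and 2
  put the endpoints in the required order for any compatible family. With first letters 2 and 1,
  the hypothesis forces both points to be the common endpoint of the two adjacent intervals;
  this happens only if the words continue as \<open>1\<dots>1\<close> with \<open>e = 0\<close> and as \<open>2\<dots>2\<close> with \<open>e' = 1\<close>, a
  condition that does not involve the family.\<close>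

lemma endpoint_order:
  assumes "i \<in> {1,2}" "set u \<subseteq> {1,2}" "set v \<subseteq> {1,2}" "e \<in> {0,1}" "e' \<in> {0,1}"
    and "word_map f i u e \<le> word_map f i v e'"
  shows "word_map g i u e \<le> word_map g i v e'"
  using assms
proof (induction u v arbitrary: i rule: list_induct2')
  case 1
  then show ?case by simp
next
  case (2 j u)
  then show ?case
    using F.word_map_in_unit[of i "j # u" e] G.word_map_in_unit[of i "j # u" e]
      F.word_map_eq_0[of i "j # u" e] G.word_map_eq_0[of i "j # u" e] by auto
next
  case (3 k v)
  then show ?case
    using F.word_map_in_unit[of i "k # v" e'] G.word_map_in_unit[of i "k # v" e']
      F.word_map_eq_1[of i "k # v" e'] G.word_map_eq_1[of i "k # v" e'] by auto
next
  case (4 j u k v)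
  have jk: "j \<in> {1,2}" "k \<in> {1,2}" and uv: "set u \<subseteq> {1,2}" "set v \<subseteq> {1,2}"
    and e: "e \<in> {0..1}" "e' \<in> {0..1}"
    using 4 by auto
  let ?a = "word_map f j u e" and ?b = "word_map f k v e'"
  let ?c = "word_map g j u e" and ?d = "word_map g k v e'"
  have in_unit: "?a \<in> {0..1}" "?b \<in> {0..1}" "?c \<in> {0..1}" "?d \<in> {0..1}"
    using jk uv e by (auto intro!: F.word_map_in_unit G.word_map_in_unit simp del: atLeastAtMost_iff)
  have le: "f i j ?a \<le> f i k ?b"
    using 4 by simp
  consider "j = k" | "j = 1" "k = 2" | "j = 2" "k = 1"
    using jk by auto
  then have "g i j ?c \<le> g i k ?d"
  proof cases
    case 1
    then have "?a \<le> ?b"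
      using le in_unit jk 4(2) F.le_iff[of i j ?a ?b] by simp
    then have "?c \<le> ?d"
      using 4(1)[of j] 1 jk uv 4(5,6) by simp
    then show ?thesis
      using 1 in_unit jk 4(2) G.le_iff[of i j ?c ?d] by simp
  next
    case 2
    have "g i 1 ?c \<le> g i 1 1" "g i 2 0 \<le> g i 2 ?d"
      using in_unit 4(2) G.le_iff[of i 1 ?c 1] G.le_iff[of i 2 0 ?d] by auto
    with 2 G.endpoints[of i] 4(2) show ?thesis by simp
  next
    case 3
    then have "?a = 0" "?b = 1"
      using F.ranges_meet[of i ?a ?b] le in_unit 4(2) by auto
    then have "?c = 0" "?d = 1"
      using F.word_map_eq_0[of j u e] G.word_map_eq_0[of j u e]
        F.word_map_eq_1[of k v e'] G.word_map_eq_1[of k v e'] jk uv e by auto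
    with 3 G.endpoints[of i] 4(2) show ?thesis by simp
  qed
  then show ?case by simp
qed

lemma conjugate_mono:
  assumes "i \<in> {1,2}" "conjugate f g i x y" "conjugate f g i x' y'" "x \<le> x'"
  shows "y \<le> y'"
proof -
  have "y - y' \<le> 2 * (\<phi> ^^ n) 1" for n
  proof -
    from assms(2) obtain u where u: "length u = n" "set u \<subseteq> {1,2}"
      "x \<in> word_interval f i u" "y \<in> word_interval g i u"
      unfolding conjugate_def by blast
    from assms(3) obtain v where v: "length v = n" "set v \<subseteq> {1,2}"
      "x' \<in> word_interval f i v" "y' \<in> word_interval g i v"
      unfolding conjugate_def by blast
    have "word_map g i u 0 \<le> word_map g i v 1"
      using u v assms by (intro endpoint_order) (auto simp: word_interval_def)
    with u v G.word_interval_length[of i u] G.word_interval_length[of i v] assms(1)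
    show ?thesis by (auto simp: word_interval_def)
  qed
  moreover have "(\<lambda>n. 2 * (\<phi> ^^ n) 1) \<longlonglongrightarrow> 0"
    using tendsto_mult_right_zero[OF F.iterates_tendsto] by simp
  ultimately have "y - y' \<le> 0"
    using LIMSEQ_le_const by blast
  then show ?thesis by simp
qed

lemma conjugate_unique:
  assumes "i \<in> {1,2}" "conjugate f g i x y" "conjugate f g i x y'"
  shows "y = y'"
  using conjugate_mono[of i x y x y'] conjugate_mono[of i x y' x y] assms by auto

lemma conjugate_endpoint:
  assumes "i \<in> {1,2}" "set w \<subseteq> {1,2}" "e \<in> {0,1}"
  shows "conjugate f g i (word_map f i w e) (word_map g i w e)"
  unfolding conjugate_def
proof
  fix n
  have "word_map f i w e \<in> {0..1}"
    using assms by (intro F.word_map_in_unit) auto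
  with assms(1) obtain v where v: "length v = n" "set v \<subseteq> {1,2}"
    "word_map f i w e \<in> word_interval f i v"
    by (rule F.word_exists)
  moreover from v have "word_map g i w e \<in> word_interval g i v"
    using assms endpoint_order[of i v w 0 e] endpoint_order[of i w v e 1]
    by (simp add: word_interval_def)
  ultimately show "\<exists>v. length v = n \<and> set v \<subseteq> {1,2} \<and>
      word_map f i w e \<in> word_interval f i v \<and> word_map g i w e \<in> word_interval g i v"
    by blast
qed

lemma conjugate_assoc_map:
  assumes "i \<in> {1,2}" "x \<in> {0..1}"
  shows "conjugate f g i x (assoc_map f g i x)"
proof (cases "x \<in> D_set f i")
  case True
  \<comment> \<open>Every value admitted by the definite description is conjugate to \<open>x\<close>, so there is only one.\<close>
  let ?P = "\<lambda>y. \<exists>w e. w \<noteq> [] \<and> set w \<subseteq> {1,2} \<and> e \<in> {0,1} \<and>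
                     x = word_map f i w e \<and> y = word_map g i w e"
  have conj: "conjugate f g i x y" if "?P y" for y
    using that conjugate_endpoint assms(1) by blast
  obtain y where y: "?P y"
    using True unfolding F.D_set_iff by blast
  then have "?P (THE y. ?P y)"
  proof (rule theI)
    show "y' = y" if "?P y'" for y'
      using conjugate_unique[OF assms(1) conj[OF that] conj[OF y]] .
  qed
  with True conj show ?thesis
    by (simp add: assoc_map_def)
next
  case False
  define s where "s = (THE s. is_itinerary f i x s)"
  have s: "is_itinerary f i x s"
    unfolding s_def using assms False by (rule F.the_itinerary)
  then have range: "range s \<subseteq> {1,2}"
    by (simp add: is_itinerary_def)
  then obtain y where y: "(\<Inter>n\<in>{1..}. word_interval g i (map s [0..<n])) = {y}"
    using G.Inter_word_intervals assms(1) by blast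
  then have "assoc_map f g i x = y"
    using False by (simp add: assoc_map_def s_def)
  moreover have "conjugate f g i x y"
    unfolding conjugate_def
  proof
    fix n
    have y_in: "y \<in> word_interval g i (map s [0..<m])" if "m \<ge> 1" for m
      using y that by blast
    show "\<exists>w. length w = n \<and> set w \<subseteq> {1,2} \<and> x \<in> word_interval f i w \<and> y \<in> word_interval g i w"
    proof (cases "n = 0")
      case True
      have "y \<in> {0..1}"
        using y_in[of 1] G.word_interval_subset_unit[OF assms(1), of "map s [0..<1]"] range
        by (auto simp: image_subset_iff)
      with True assms(2) show ?thesis by (simp add: word_interval_def)
    next
      case False
      with s y_in[of n] range show ?thesis
        by (intro exI[of _ "map s [0..<n]"]) (auto simp: is_itinerary_def)
    qed
  qed
  ultimately show ?thesis by simp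
qed

lemma conjugate_in_unit:
  "conjugate f g i x y \<Longrightarrow> x \<in> {0..1} \<and> y \<in> {0..1}"
  unfolding conjugate_def by (drule spec[of _ 0]) (auto simp: word_interval_def)

lemma conjugate_iff:
  assumes "i \<in> {1,2}"
  shows "conjugate f g i x y \<longleftrightarrow> x \<in> {0..1} \<and> y = assoc_map f g i x"
proof
  assume "conjugate f g i x y"
  moreover from this have "x \<in> {0..1}"
    by (blast dest: conjugate_in_unit)
  ultimately show "x \<in> {0..1} \<and> y = assoc_map f g i x"
    using conjugate_unique[OF assms] conjugate_assoc_map[OF assms] by blast
qed (simp add: conjugate_assoc_map[OF assms] del: atLeastAtMost_iff)

section \<open>Properties of the associated maps\<close>

lemma mono_assoc_map:
  assumes "i \<in> {1,2}"
  shows "mono_on {0..1} (assoc_map f g i)"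
proof (rule mono_onI)
  fix x x' :: real assume x: "x \<in> {0..1}" "x' \<in> {0..1}" "x \<le> x'"
  show "assoc_map f g i x \<le> assoc_map f g i x'"
    by (rule conjugate_mono[OF assms conjugate_assoc_map conjugate_assoc_map x(3)])
      (rule assms x)+
qed

lemma continuous_assoc_map:
  assumes "i \<in> {1,2}"
  shows "continuous_on {0..1} (assoc_map f g i)"
proof -
  have "(\<lambda>x. (x, assoc_map f g i x)) ` {0..1} = {(x, y). conjugate f g i x y}"
    by (auto simp: conjugate_iff[OF assms])
  then have "closed ((\<lambda>x. (x, assoc_map f g i x)) ` {0..1})"
    using closed_conjugate by simp
  moreover have "assoc_map f g i \<in> {0..1} \<rightarrow> {0..1}"
    using conjugate_assoc_map[OF assms] conjugate_in_unit by blast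
  ultimately show ?thesis
    by (intro continuous_from_closed_graph[of "{0..1}"]) auto
qed

lemma conjugate_Cons:
  assumes "k \<in> {1,2}" "j \<in> {1,2}" "conjugate f g j x y"
  shows "conjugate f g k (f k j x) (g k j y)"
  unfolding conjugate_def
proof
  fix n
  show "\<exists>w. length w = n \<and> set w \<subseteq> {1,2} \<and>
      f k j x \<in> word_interval f k w \<and> g k j y \<in> word_interval g k w"
  proof (cases n)
    case 0
    have "f k j x \<in> {0..1}" "g k j y \<in> {0..1}"
      using assms conjugate_in_unit[OF assms(3)] F.in_unit[of k j x] G.in_unit[of k j y] by auto
    with 0 show ?thesis by (simp add: word_interval_def)
  next
    case (Suc m)
    from assms(3) obtain w where "length w = m" "set w \<subseteq> {1,2}"
      "x \<in> word_interval f j w" "y \<in> word_interval g j w"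
      unfolding conjugate_def by blast
    with Suc assms F.word_interval_Cons[of k j w x] G.word_interval_Cons[of k j w y]
    show ?thesis by (intro exI[of _ "j # w"]) auto
  qed
qed

lemma assoc_map_equation:
  assumes "k \<in> {1,2}" "j \<in> {1,2}" "x \<in> {0..1}"
  shows "g k j (assoc_map f g j x) = assoc_map f g k (f k j x)"
  using conjugate_Cons[OF assms(1,2) conjugate_assoc_map[OF assms(2,3)]] assms(1)
  by (simp add: conjugate_iff)

end

theorem proposition5p1:
  fixes \<phi> :: "real \<Rightarrow> real"
    and f g :: "nat \<Rightarrow> nat \<Rightarrow> real \<Rightarrow> real"
    and i :: nat
  assumes "compatible_family \<phi> f"
    and "compatible_family \<phi> g"
    and "i \<in> {1,2}"
  shows "mono_on {0..1} (assoc_map f g i) \<and>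
         continuous_on {0..1} (assoc_map f g i) \<and>
         (\<forall>k\<in>{1,2}. \<forall>j\<in>{1,2}. \<forall>x\<in>{0..1}.
            g k j (assoc_map f g j x) = assoc_map f g k (f k j x))"
proof -
  interpret compatible_pair \<phi> f g
    using assms by unfold_locales
  show ?thesis
    using mono_assoc_map continuous_assoc_map assoc_map_equation assms(3) by blast
qed

end
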